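(* For $n\ge 0$ let $s_n$ be the number of stable LEGO walls of width $7$ and height $n$ built using bricks of length $2$, $3$, and $4$. Then $$\sum_{n\ge 0}s_nt^n=\frac{1+3t-2t^3}{1-2t-2t^2+2t^3}.$$
   Context: A LEGO wall of width $7$ and height $n$ using bricks of length $2,3,4$ consists of $n$ levels stacked on each other, where each level is a row of bricks of lengths in $\{2,3,4\}$ placed side by side with total length $7$, i.e. each level is a sequence $(b_1,\ldots,b_r)$ with $b_i\in\{2,3,4\}$ and $b_1+\cdots+b_r=7$. The seams of a level are the interior positions $b_1,\,b_1+b_2,\ldots,\,b_1+\cdots+b_{r-1}$ where two bricks of that level meet. A wall is stable if seams do not match up from one level to the next, i.e. no two consecutive levels have a seam at the same position. By convention there is exactly one wall of height $0$. *)

theory Defs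
  imports "HOL-Computational_Algebra.Formal_Power_Series"
begin

definition is_level :: "nat set \<Rightarrow> nat \<Rightarrow> nat list \<Rightarrow> bool" where
  "is_level B w bs \<longleftrightarrow> set bs \<subseteq> B \<and> sum_list bs = w"

definition seams :: "nat list \<Rightarrow> nat set" where
  "seams bs = {sum_list (take k bs) | k. 1 \<le> k \<and> k < length bs}"

definition lego_wall :: "nat set \<Rightarrow> nat \<Rightarrow> nat \<Rightarrow> nat list list \<Rightarrow> bool" where
  "lego_wall B w n W \<longleftrightarrow> length W = n \<and> (\<forall>L \<in> set W. is_level B w L)"

definition stable :: "nat list list \<Rightarrow> bool" where
  "stable W \<longleftrightarrow> (\<forall>i. Suc i < length W \<longrightarrow> seams (W ! i) \<inter> seams (W ! Suc i) = {})"

(* The set of walls is infinite, and card then yields 0, only if 0 is in B; brick lengths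
   are meant to be positive. *)
definition num_stable_walls :: "nat set \<Rightarrow> nat \<Rightarrow> nat \<Rightarrow> nat" where
  "num_stable_walls B w n = card {W. lego_wall B w n W \<and> stable W}"

end

(* Transfer matrix method. There are five levels: (3,4), (4,3), (2,2,3), (3,2,2), (2,3,2).
   The number of stable walls on top of a given level is invariant under mirroring, so it takes
   three values, whose generating functions a, c, d satisfy
     a = 1 + t(a + c + d),  c = 1 + t(a + c),  d = 1 + 2ta;
   the series sought is 1 + t(2a + 2c + d). *)
theory Submission imports Defs
begin

lemma seams_single [simp]: "seams [x] = {}"
  by (auto simp: seams_def)

text \<open>A nonempty proper prefix of \<open>x # y # zs\<close> is either \<open>[x]\<close> or
  \<open>x\<close> followed by a nonempty proper prefix of \<open>y # zs\<close>. As a simp rule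
  this computes the seams of any concrete level.\<close>

lemma seams_Cons_Cons [simp]: "seams (x # y # zs) = insert x ((+) x ` seams (y # zs))"
proof (intro set_eqI iffI)
  fix s assume "s \<in> seams (x # y # zs)"
  then obtain k where k: "s = sum_list (take k (x # y # zs))" "1 \<le> k" "k < length (x # y # zs)"
    unfolding seams_def by blast
  then obtain j where j: "k = Suc j" by (cases k) auto
  show "s \<in> insert x ((+) x ` seams (y # zs))"
  proof (cases "j = 0")
    case False
    then have "sum_list (take j (y # zs)) \<in> seams (y # zs)"
      using k j unfolding seams_def by auto
    then show ?thesis using k j by simp
  qed (use k j in simp)
next
  fix s assume "s \<in> insert x ((+) x ` seams (y # zs))"
  then consider "s = x"
    | k where "s = x + sum_list (take k (y # zs))" "1 \<le> k" "k < length (y # zs)"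
    unfolding seams_def by blast
  then show "s \<in> seams (x # y # zs)"
  proof cases
    case 1
    then show ?thesis unfolding seams_def by (auto intro!: exI[of _ 1])
  next
    case (2 k)
    then show ?thesis unfolding seams_def by (auto intro!: exI[of _ "Suc k"])
  qed
qed

lemma stable_Nil [simp]: "stable []"
  by (simp add: stable_def)

lemma stable_single [simp]: "stable [L]"
  by (simp add: stable_def)

lemma stable_Cons_Cons [simp]:
  "stable (L # M # W) \<longleftrightarrow> seams L \<inter> seams M = {} \<and> stable (M # W)"
proof -
  \<comment> \<open>Index 0 is the contact of \<open>L\<close> with \<open>M\<close>; the shifted
    indices are the contacts inside \<open>M # W\<close>.\<close>
  have *: "(\<forall>i. P i) \<longleftrightarrow> P 0 \<and> (\<forall>i. P (Suc i))" for P
    by (metis not0_implies_Suc)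
  show ?thesis unfolding stable_def by (subst *) simp
qed

lemma lego_wall_0 [simp]: "lego_wall B w 0 W \<longleftrightarrow> W = []"
  by (auto simp: lego_wall_def)

lemma lego_wall_Suc:
  "lego_wall B w (Suc n) W \<longleftrightarrow> (\<exists>L V. W = L # V \<and> is_level B w L \<and> lego_wall B w n V)"
  by (cases W) (auto simp: lego_wall_def)

lemma finite_lego_walls:
  assumes "finite {L. is_level B w L}"
  shows "finite {W. lego_wall B w n W}"
proof -
  have "{W. lego_wall B w n W} = {W. set W \<subseteq> {L. is_level B w L} \<and> length W = n}"
    by (auto simp: lego_wall_def)
  then show ?thesis using finite_lists_length_eq[OF assms] by simp
qed

text \<open>State of the transfer matrix: \<open>L\<close> is the level already laid and is not
  counted in the height \<open>n\<close>.\<close>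

definition walls_above :: "nat set \<Rightarrow> nat \<Rightarrow> nat list \<Rightarrow> nat \<Rightarrow> nat" where
  "walls_above B w L n = card {W. lego_wall B w n W \<and> stable (L # W)}"

lemma walls_above_0 [simp]: "walls_above B w L 0 = 1"
proof -
  have "{W. lego_wall B w 0 W \<and> stable (L # W)} = {[]}" by auto
  then show ?thesis by (simp add: walls_above_def)
qed

lemma num_stable_walls_0 [simp]: "num_stable_walls B w 0 = 1"
proof -
  have "{W. lego_wall B w 0 W \<and> stable W} = {[]}" by auto
  then show ?thesis by (simp add: num_stable_walls_def)
qed

text \<open>A nonempty wall determines its first level and the rest, so the count is that of a
  disjoint union. \<open>P\<close> is trivial for all walls and is seam disjointness for walls on a
  given level.\<close>

lemma card_walls_by_first_level:
  assumes fin: "finite {L. is_level B w L}"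
  shows "card {L # V |L V. is_level B w L \<and> P L \<and> lego_wall B w n V \<and> stable (L # V)}
       = (\<Sum>L | is_level B w L \<and> P L. walls_above B w L n)"
proof -
  let ?A = "{L. is_level B w L \<and> P L}"
  let ?V = "\<lambda>L. {V. lego_wall B w n V \<and> stable (L # V)}"
  have "{L # V |L V. is_level B w L \<and> P L \<and> lego_wall B w n V \<and> stable (L # V)}
      = (\<lambda>(L, V). L # V) ` Sigma ?A ?V"
    by auto
  moreover have "inj_on (\<lambda>(L, V). L # V) (Sigma ?A ?V)"
    by (auto simp: inj_on_def)
  moreover have "finite ?A" "finite (?V L)" for L
    using fin finite_lego_walls[OF fin] by auto
  ultimately show ?thesis by (simp add: card_image walls_above_def)
qed

lemma num_stable_walls_Suc:
  assumes "finite {L. is_level B w L}"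
  shows "num_stable_walls B w (Suc n) = (\<Sum>L | is_level B w L. walls_above B w L n)"
proof -
  have "{W. lego_wall B w (Suc n) W \<and> stable W}
      = {L # V |L V. is_level B w L \<and> True \<and> lego_wall B w n V \<and> stable (L # V)}"
    by (auto simp: lego_wall_Suc)
  then show ?thesis
    using card_walls_by_first_level[OF assms, of "\<lambda>_. True" n] by (simp add: num_stable_walls_def)
qed

lemma walls_above_Suc:
  assumes "finite {L. is_level B w L}"
  shows "walls_above B w L (Suc n)
       = (\<Sum>M | is_level B w M \<and> seams L \<inter> seams M = {}. walls_above B w M n)"
proof -
  have "{W. lego_wall B w (Suc n) W \<and> stable (L # W)}
      = {M # V |M V. is_level B w M \<and> seams L \<inter> seams M = {} \<and> lego_wall B w n V \<and> stable (M # V)}"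
    by (auto simp: lego_wall_Suc)
  then show ?thesis
    using card_walls_by_first_level[OF assms, of "\<lambda>M. seams L \<inter> seams M = {}" n]
    by (simp add: walls_above_def)
qed

text \<open>Every brick has length at least 2, so four bricks already exceed 7; at most three bricks
  leave finitely many cases.\<close>

lemma levels_7:
  "{L. is_level {2, 3, 4} 7 L} = {[3, 4], [4, 3], [2, 2, 3], [3, 2, 2], [2, 3, 2]}"
proof (intro set_eqI iffI)
  fix L assume "L \<in> {L. is_level {2, 3, 4} 7 L}"
  then have L: "set L \<subseteq> {2, 3, 4}" "sum_list L = 7" by (auto simp: is_level_def)
  consider "L = []" | a where "L = [a]" | a b where "L = [a, b]" | a b c where "L = [a, b, c]"
    | a b c d M where "L = a # b # c # d # M"
    by (metis list.exhaust)
  then show "L \<in> {[3, 4], [4, 3], [2, 2, 3], [3, 2, 2], [2, 3, 2]}"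
    using L by cases auto
qed (auto simp: is_level_def)

lemma walls_above_7_Suc:
  "walls_above {2, 3, 4} 7 L (Suc n)
   = (\<Sum>M \<in> {[3, 4], [4, 3], [2, 2, 3], [3, 2, 2], [2, 3, 2]}.
        if seams L \<inter> seams M = {} then walls_above {2, 3, 4} 7 M n else 0)"
proof -
  have "{M. is_level {2, 3, 4} 7 M \<and> seams L \<inter> seams M = {}}
      = {M \<in> {L. is_level {2, 3, 4} 7 L}. seams L \<inter> seams M = {}}"
    by auto
  moreover have "finite {L. is_level {2, 3, 4} 7 L}" by (simp add: levels_7)
  ultimately show ?thesis
    \<comment> \<open>The filter becomes an \<open>if\<close> before the five levels are listed, so
      that \<open>simp\<close> can later decide each seam condition separately.\<close>
    by (simp only: walls_above_Suc sum.inter_filter) (simp only: levels_7)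
qed

text \<open>The seam sets, in the order of the equations, are {3}, {4}, {2,4}, {3,5}, {2,5}; each
  right-hand side collects the levels with disjoint seams.\<close>

lemma walls_above_7_recs:
  fixes f defines "f \<equiv> walls_above {2, 3, 4} 7"
  shows "f [3, 4] (Suc n) = f [4, 3] n + f [2, 2, 3] n + f [2, 3, 2] n"
    and "f [4, 3] (Suc n) = f [3, 4] n + f [3, 2, 2] n + f [2, 3, 2] n"
    and "f [2, 2, 3] (Suc n) = f [3, 4] n + f [3, 2, 2] n"
    and "f [3, 2, 2] (Suc n) = f [4, 3] n + f [2, 2, 3] n"
    and "f [2, 3, 2] (Suc n) = f [3, 4] n + f [4, 3] n"
  unfolding f_def walls_above_7_Suc by simp_all

text \<open>Mirroring sends a seam s to 7 - s and permutes the recurrences. The two claims need each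
  other's induction hypothesis.\<close>

lemma walls_above_7_mirror:
  "walls_above {2, 3, 4} 7 [4, 3] n = walls_above {2, 3, 4} 7 [3, 4] n"
  "walls_above {2, 3, 4} 7 [3, 2, 2] n = walls_above {2, 3, 4} 7 [2, 2, 3] n"
  by (induction n) (simp_all add: walls_above_7_recs)

text \<open>Multiplication by \<open>fps_X\<close> shifts coefficients; this turns recurrences into
  equations between generating functions.\<close>

lemma fps_eq_const_plus_X_mult:
  fixes f :: "'a :: comm_semiring_1 fps"
  assumes "\<And>n. fps_nth f (Suc n) = fps_nth g n"
  shows "f = fps_const (fps_nth f 0) + fps_X * g"
proof (rule fps_ext)
  fix n show "fps_nth f n = fps_nth (fps_const (fps_nth f 0) + fps_X * g) n"
    using assms by (cases n) simp_all
qed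

theorem mainTheorem7:
  "Abs_fps (\<lambda>n. of_nat (num_stable_walls {2, 3, 4} 7 n) :: rat)
     = (1 + 3 * fps_X - 2 * fps_X ^ 3) / (1 - 2 * fps_X - 2 * fps_X ^ 2 + 2 * fps_X ^ 3)"
proof -
  define F where "F L = Abs_fps (\<lambda>n. of_nat (walls_above {2, 3, 4} 7 L n) :: rat)" for L
  define a c d where "a = F [3, 4]" and "c = F [2, 2, 3]" and "d = F [2, 3, 2]"
  let ?S = "Abs_fps (\<lambda>n. of_nat (num_stable_walls {2, 3, 4} 7 n) :: rat)"
  let ?D = "1 - 2 * fps_X - 2 * fps_X ^ 2 + 2 * fps_X ^ 3 :: rat fps"
  note defs = a_def c_def d_def F_def
  note recs = walls_above_7_recs walls_above_7_mirror
  have a: "a = 1 + fps_X * (a + c + d)"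
    using fps_eq_const_plus_X_mult[of a "a + c + d"] by (simp add: defs recs)
  have c: "c = 1 + fps_X * (a + c)"
    using fps_eq_const_plus_X_mult[of c "a + c"] by (simp add: defs recs)
  have d: "d = 1 + fps_X * (2 * a)"
    using fps_eq_const_plus_X_mult[of d "fps_const 2 * a"] by (simp add: defs recs numeral_fps_const)
  \<comment> \<open>The 1 is the empty wall; each factor 2 counts a mirror pair of first
    levels.\<close>
  have S: "?S = 1 + fps_X * (2 * a + 2 * c + d)"
    using fps_eq_const_plus_X_mult[of ?S "fps_const 2 * a + fps_const 2 * c + d"]
    by (simp add: defs num_stable_walls_Suc levels_7 walls_above_7_mirror numeral_fps_const)
  \<comment> \<open>\<open>?D\<close> is the determinant of the linear system for \<open>a\<close>,
    \<open>c\<close>, \<open>d\<close>, so eliminating them leaves a polynomial.\<close>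
  have "?S * ?D = 1 + 3 * fps_X - 2 * fps_X ^ 3"
    using a c d S by algebra
  \<comment> \<open>The constant coefficient is 1, which permits cancelling
    \<open>?D\<close>.\<close>
  moreover have "?D \<noteq> 0"
  proof
    assume "?D = 0"
    then have "fps_nth ?D 0 = 0" by (simp only: fps_zero_nth)
    then show False by simp
  qed
  ultimately show ?thesis
    by (metis nonzero_mult_div_cancel_right)
qed

end
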